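(* Let $\sigma \colon [0,l] \to X_{\mathrm{valid}}$ be a path in $\Sigma$ with arc length $l$. Let $0 \leq t_1 \leq l$ and let $\delta_1 := \delta(\sigma(t_1))$ be the clearance of the state $\sigma(t_1)$. Then the reciprocal clearance cost of $\sigma$ satisfies $$c(\sigma) \geq \ln\left( \frac{\delta_1 + t_1}{\delta_1} \right) + \ln\left( \frac{\delta_1 + l - t_1}{\delta_1} \right).$$
   Context: $X$ is a state space, taken to be a subset of a real normed vector space with norm $\|\cdot\|$. $X_{\mathrm{invalid}} \subseteq X$ is the (nonempty) subset of invalid states and $X_{\mathrm{valid}} := X \setminus X_{\mathrm{invalid}}$ is the subset of valid states. The clearance of a valid state is $\delta(\mathbf{x}) := \min_{\mathbf{x}' \in X_{\mathrm{invalid}}} \|\mathbf{x} - \mathbf{x}'\|$; it is assumed that this minimum is attained and is strictly positive for every valid state, so $\delta \colon X_{\mathrm{valid}} \to (0,\infty)$. A path is a continuous function $\sigma \colon [0,l] \to X_{\mathrm{valid}}$ with $0 \leq l < \infty$, parameterized by arc length: for all $0 \leq s \leq t \leq l$ the restriction of $\sigma$ to $[s,t]$ has length $t-s$ with respect to $\|\cdot\|$. The number $l$ is the arc length of $\sigma$. $\Sigma$ denotes the set of all such paths. The reciprocal clearance cost of $\sigma \in \Sigma$ is $c(\sigma) := \int_0^l \frac{1}{\delta(\sigma(t))}\,dt$. *)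

theory Defs
  imports "HOL-Analysis.Analysis"
begin

text \<open>The \<open>LEAST\<close> operator is a genuine minimum: the value is meaningful only when the minimum of
  the distances is attained, which users of this definition have to assume.\<close>

definition clearance :: "'a::real_normed_vector set \<Rightarrow> 'a \<Rightarrow> real" where
  "clearance Xinv x = (LEAST d. \<exists>x'\<in>Xinv. d = norm (x - x'))"

text \<open>The length of the restriction of \<open>\<sigma>\<close> to \<open>{a..b}\<close> (for \<open>a \<le> b\<close>) is the supremum, in the
  extended reals, of the lengths of the inscribed polygonal chains with parameters
  \<open>a = p 0 \<le> p 1 \<le> \<dots> \<le> p n = b\<close>.\<close>

definition curve_length :: "(real \<Rightarrow> 'a::real_normed_vector) \<Rightarrow> real \<Rightarrow> real \<Rightarrow> ereal" where
  "curve_length \<sigma> a b =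
     Sup {ereal (\<Sum>i<n. norm (\<sigma> (p (Suc i)) - \<sigma> (p i))) | (n::nat) (p::nat \<Rightarrow> real).
            p 0 = a \<and> p n = b \<and> (\<forall>i<n. p i \<le> p (Suc i))}"

text \<open>A path \<open>[0,l] \<rightarrow> V\<close> is represented by its arc length \<open>l\<close> and a total function \<open>\<sigma>\<close>, of which
  only the values on \<open>{0..l}\<close> matter.\<close>

definition arc_length_path :: "'a::real_normed_vector set \<Rightarrow> real \<Rightarrow> (real \<Rightarrow> 'a) \<Rightarrow> bool" where
  "arc_length_path V l \<sigma> \<longleftrightarrow>
     0 \<le> l \<and> continuous_on {0..l} \<sigma> \<and> \<sigma> ` {0..l} \<subseteq> V \<and>
     (\<forall>s t. 0 \<le> s \<and> s \<le> t \<and> t \<le> l \<longrightarrow> curve_length \<sigma> s t = ereal (t - s))"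

definition reciprocal_clearance_cost ::
    "'a::real_normed_vector set \<Rightarrow> real \<Rightarrow> (real \<Rightarrow> 'a) \<Rightarrow> real" where
  "reciprocal_clearance_cost Xinv l \<sigma> = integral {0..l} (\<lambda>t. 1 / clearance Xinv (\<sigma> t))"

end

theory Submission
  imports Defs
begin

text \<open>Clearance is a distance function, hence 1-Lipschitz, and a path parameterized by arc length
  is 1-Lipschitz as well. So the clearance at time \<open>t\<close> is at most \<open>\<delta>\<^sub>1 + \<bar>t - t\<^sub>1\<bar>\<close>, and the two
  logarithms are the integrals of the reciprocal of this bound before and after \<open>t\<^sub>1\<close>.\<close>

text \<open>A nearest point of \<open>A\<close> realizes both the least element of the set of
  distances and their infimum. The identification makes the triangle inequality and the continuity
  of \<open>infdist\<close> available for the clearance.\<close>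

lemma clearance_eq_infdist:
  assumes "\<exists>x'\<in>A. \<forall>y\<in>A. norm (x - x') \<le> norm (x - y)"
  shows "clearance A x = infdist x A"
proof -
  obtain x' where x': "x' \<in> A" "\<And>y. y \<in> A \<Longrightarrow> norm (x - x') \<le> norm (x - y)"
    using assms by blast
  have "clearance A x = norm (x - x')"
    unfolding clearance_def using x' by (intro Least_equality) auto
  moreover have "infdist x A = norm (x - x')"
  proof (rule antisym)
    show "infdist x A \<le> norm (x - x')"
      using infdist_le[OF x'(1), of x] by (simp add: dist_norm)
    \<comment> \<open>\<open>infdist\<close> to the empty set is 0 by convention, so nonemptiness is
      what turns it into a true infimum.\<close>
    have "A \<noteq> {}"
      using x'(1) by blast
    then show "norm (x - x') \<le> infdist x A"
      using x' by (auto simp: infdist_def dist_norm intro!: cINF_greatest)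
  qed
  ultimately show ?thesis by simp
qed

text \<open>The chord is itself an inscribed polygonal chain, the one with a single segment, so the
  supremum dominates its length.\<close>

lemma norm_diff_le_curve_length:
  assumes "s \<le> t"
  shows "ereal (norm (\<sigma> t - \<sigma> s)) \<le> curve_length \<sigma> s t"
  unfolding curve_length_def
proof (rule Sup_upper, safe)
  show "\<exists>n p. ereal (norm (\<sigma> t - \<sigma> s)) = ereal (\<Sum>i<n. norm (\<sigma> (p (Suc i)) - \<sigma> (p i))) \<and>
          p 0 = s \<and> p n = t \<and> (\<forall>i<n. p i \<le> p (Suc i))"
    using assms by (intro exI[of _ 1] exI[of _ "\<lambda>i. if i = 0 then s else t"]) auto
qed

lemma arc_length_path_dist_le:
  assumes path: "arc_length_path V l \<sigma>" and "s \<in> {0..l}" "t \<in> {0..l}"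
  shows "dist (\<sigma> s) (\<sigma> t) \<le> \<bar>s - t\<bar>"
proof -
  have *: "dist (\<sigma> s) (\<sigma> t) \<le> t - s" if "0 \<le> s" "s \<le> t" "t \<le> l" for s t
    using norm_diff_le_curve_length[of s t \<sigma>] path that
    by (simp add: arc_length_path_def dist_norm norm_minus_commute)
  show ?thesis
    using *[of s t] *[of t s] assms(2,3) by (cases "s \<le> t") (auto simp: dist_commute)
qed

text \<open>An antiderivative is \<open>ln (d + (t - a))\<close>; its argument stays positive on
  \<open>{a..b}\<close> because \<open>0 < d\<close>.\<close>

lemma has_integral_inverse_after:
  fixes a b d :: real
  assumes "0 < d" "a \<le> b"
  shows "((\<lambda>t. 1 / (d + (t - a))) has_integral ln ((d + (b - a)) / d)) {a..b}"
proof -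
  have "((\<lambda>t. 1 / (d + (t - a))) has_integral ln (d + (b - a)) - ln (d + (a - a))) {a..b}"
    using assms by (intro fundamental_theorem_of_calculus)
      (auto intro!: derivative_eq_intros simp: has_real_derivative_iff_has_vector_derivative[symmetric])
  then show ?thesis
    using assms by (simp add: ln_div)
qed

text \<open>Mirror image of the previous integral: the antiderivative is now
  \<open>- ln (d + (b - t))\<close>, which accounts for the double minus sign below.\<close>

lemma has_integral_inverse_before:
  fixes a b d :: real
  assumes "0 < d" "a \<le> b"
  shows "((\<lambda>t. 1 / (d + (b - t))) has_integral ln ((d + (b - a)) / d)) {a..b}"
proof -
  have "((\<lambda>t. 1 / (d + (b - t))) has_integral - ln (d + (b - b)) - - ln (d + (b - a))) {a..b}"
    using assms by (intro fundamental_theorem_of_calculus)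
      (auto intro!: derivative_eq_intros simp: has_real_derivative_iff_has_vector_derivative[symmetric])
  then show ?thesis
    using assms by (simp add: ln_div)
qed

theorem lemma3:
  fixes X Xinv :: "'a::real_normed_vector set"
    and \<sigma> :: "real \<Rightarrow> 'a" and l t\<^sub>1 \<delta>\<^sub>1 :: real
  assumes "Xinv \<subseteq> X" and "Xinv \<noteq> {}"
    and min_attained: "\<forall>x \<in> X - Xinv. \<exists>x' \<in> Xinv. \<forall>y \<in> Xinv. norm (x - x') \<le> norm (x - y)"
    and clearance_pos: "\<forall>x \<in> X - Xinv. 0 < clearance Xinv x"
    and path: "arc_length_path (X - Xinv) l \<sigma>"
    and "0 \<le> t\<^sub>1" and "t\<^sub>1 \<le> l"
    and "\<delta>\<^sub>1 = clearance Xinv (\<sigma> t\<^sub>1)"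
  shows "reciprocal_clearance_cost Xinv l \<sigma>
           \<ge> ln ((\<delta>\<^sub>1 + t\<^sub>1) / \<delta>\<^sub>1) + ln ((\<delta>\<^sub>1 + l - t\<^sub>1) / \<delta>\<^sub>1)"
proof -
  \<comment> \<open>\<open>f\<close> stands in for the clearance along the path. The two are
    identified on \<open>{0..l}\<close>, where the path is valid and the minimum is therefore
    attained.\<close>
  define f where "f t = infdist (\<sigma> t) Xinv" for t
  have valid: "\<sigma> t \<in> X - Xinv" if "t \<in> {0..l}" for t
    using path that unfolding arc_length_path_def by blast
  have f_eq: "clearance Xinv (\<sigma> t) = f t" if "t \<in> {0..l}" for t
    using min_attained valid[OF that] by (simp add: f_def clearance_eq_infdist)
  have t1: "t\<^sub>1 \<in> {0..l}"
    using assms by simp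
  have f_pos: "0 < f t" if "t \<in> {0..l}" for t
    using bspec[OF clearance_pos valid[OF that]] f_eq[OF that] by simp
  have \<delta>: "\<delta>\<^sub>1 = f t\<^sub>1" "0 < \<delta>\<^sub>1"
    using assms(8) f_eq[OF t1] f_pos[OF t1] by auto
  have f_le: "f t \<le> \<delta>\<^sub>1 + \<bar>t - t\<^sub>1\<bar>" if "t \<in> {0..l}" for t
    using infdist_triangle[of "\<sigma> t" Xinv "\<sigma> t\<^sub>1"] arc_length_path_dist_le[OF path that t1]
    by (simp add: f_def \<delta>(1))
  \<comment> \<open>Continuity serves to show that the cost integral exists: \<open>integral\<close>
    of a non-integrable function is 0 by default, and then no lower bound could be read off the
    integrand.\<close>
  have "continuous_on {0..l} (\<lambda>t. 1 / f t)"
    unfolding f_def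
  proof (intro continuous_intros ballI)
    show "continuous_on {0..l} \<sigma>"
      using path by (simp add: arc_length_path_def)
    show "infdist (\<sigma> t) Xinv \<noteq> 0" if "t \<in> {0..l}" for t
      using f_pos[OF that] by (simp add: f_def)
  qed
  then have int: "(\<lambda>t. 1 / f t) integrable_on {0..l}"
    by (rule integrable_continuous_interval)
  have bound: "1 / (\<delta>\<^sub>1 + \<bar>t - t\<^sub>1\<bar>) \<le> 1 / f t" if "t \<in> {0..l}" for t
    using f_le[OF that] f_pos[OF that] by (intro divide_left_mono mult_pos_pos) auto
  \<comment> \<open>Splitting at \<open>t\<^sub>1\<close> resolves the absolute value in
    \<open>bound\<close>: it is \<open>t\<^sub>1 - t\<close> here and \<open>t - t\<^sub>1\<close>
    on the second interval. The term \<open>t\<^sub>1 - 0\<close> matches the integral lemma with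
    \<open>a = 0\<close>.\<close>
  have "ln ((\<delta>\<^sub>1 + (t\<^sub>1 - 0)) / \<delta>\<^sub>1) \<le> integral {0..t\<^sub>1} (\<lambda>t. 1 / f t)"
  proof (rule has_integral_le[OF has_integral_inverse_before[OF \<delta>(2) \<open>0 \<le> t\<^sub>1\<close>] integrable_integral])
    show "(\<lambda>t. 1 / f t) integrable_on {0..t\<^sub>1}"
      using int t1 by (auto intro: integrable_on_subinterval)
    show "1 / (\<delta>\<^sub>1 + (t\<^sub>1 - t)) \<le> 1 / f t" if "t \<in> {0..t\<^sub>1}" for t
      using bound[of t] that t1 by auto
  qed
  moreover have "ln ((\<delta>\<^sub>1 + (l - t\<^sub>1)) / \<delta>\<^sub>1) \<le> integral {t\<^sub>1..l} (\<lambda>t. 1 / f t)"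
  proof (rule has_integral_le[OF has_integral_inverse_after[OF \<delta>(2) \<open>t\<^sub>1 \<le> l\<close>] integrable_integral])
    show "(\<lambda>t. 1 / f t) integrable_on {t\<^sub>1..l}"
      using int t1 by (auto intro: integrable_on_subinterval)
    show "1 / (\<delta>\<^sub>1 + (t - t\<^sub>1)) \<le> 1 / f t" if "t \<in> {t\<^sub>1..l}" for t
      using bound[of t] that t1 by auto
  qed
  moreover have "integral {0..t\<^sub>1} (\<lambda>t. 1 / f t) + integral {t\<^sub>1..l} (\<lambda>t. 1 / f t)
      = integral {0..l} (\<lambda>t. 1 / f t)"
    using t1 int by (intro Henstock_Kurzweil_Integration.integral_combine) auto
  moreover have "reciprocal_clearance_cost Xinv l \<sigma> = integral {0..l} (\<lambda>t. 1 / f t)"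
    unfolding reciprocal_clearance_cost_def by (intro integral_cong) (simp add: f_eq)
  ultimately show ?thesis
    by (simp add: add_diff_eq)
qed

end
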